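(* If $X$ is a Lindelöf Hausdorff space, then $d(X)\leq\pi\chi(X)^{c(X)}$.
   Context: Lindelöf means that every open cover has a countable subcover (no regularity is assumed). Cardinal functions follow Juhász's conventions; in particular $\pi\chi(X)$ and $c(X)$ are by convention infinite cardinals. The density $d(X)$ is the least cardinality of a dense subset of $X$. A local $\pi$-base at $x\in X$ is a family $\mathcal{B}$ of nonempty open subsets of $X$ such that every open set containing $x$ contains a member of $\mathcal{B}$. The $\pi$-character $\pi\chi(X)$ is the least infinite cardinal $\lambda$ such that every $x\in X$ has a local $\pi$-base of cardinality at most $\lambda$. The cellularity $c(X)$ is the least infinite cardinal $\kappa$ such that every family of pairwise disjoint nonempty open subsets of $X$ has cardinality at most $\kappa$. *)

theory Defs
  imports "HOL-Analysis.Analysis"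
begin

unbundle cardinal_syntax

no_notation Set_Algebras.elt_set_eq  (infix \<open>=o\<close> 50)

text \<open>
  Cardinals are the relations \<open>r\<close> with \<open>Card_order r\<close>, compared by \<open>\<le>o\<close>; \<open>Cinfinite r\<close> says that
  \<open>r\<close> is an infinite cardinal. HOL has no type of all cardinals, so \<open>least_cardinal P\<close> is a least
  one among the cardinals on a fixed type, determined up to \<open>=o\<close>. The lemmas
  \<open>top_density\<close>, \<open>pi_character\<close> and \<open>cellularity\<close> below show that the types chosen are large
  enough: the minimum exists, and it is minimal among the cardinals on every type.
\<close>

definition least_cardinal :: "('k rel \<Rightarrow> bool) \<Rightarrow> 'k rel" where
  "least_cardinal P =
     (SOME r. Card_order r \<and> P r \<and> (\<forall>s. Card_order s \<and> P s \<longrightarrow> r \<le>o s))"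

definition dense_subset :: "'a topology \<Rightarrow> 'a set \<Rightarrow> bool" where
  "dense_subset X D \<longleftrightarrow> D \<subseteq> topspace X \<and> X closure_of D = topspace X"

definition top_density :: "'a topology \<Rightarrow> 'a rel" where
  "top_density X = least_cardinal (\<lambda>r. \<exists>D. dense_subset X D \<and> |D| =o r)"

definition local_pi_base :: "'a topology \<Rightarrow> 'a \<Rightarrow> 'a set set \<Rightarrow> bool" where
  "local_pi_base X x \<B> \<longleftrightarrow>
     (\<forall>B\<in>\<B>. openin X B \<and> B \<noteq> {}) \<and>
     (\<forall>U. openin X U \<and> x \<in> U \<longrightarrow> (\<exists>B\<in>\<B>. B \<subseteq> U))"

definition pi_character_le :: "'a topology \<Rightarrow> 'k rel \<Rightarrow> bool" where
  "pi_character_le X r \<longleftrightarrow> (\<forall>x\<in>topspace X. \<exists>\<B>. local_pi_base X x \<B> \<and> |\<B>| \<le>o r)"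

definition pi_character :: "'a topology \<Rightarrow> ('a set + nat) rel" where
  "pi_character X = least_cardinal (\<lambda>r. Cinfinite r \<and> pi_character_le X r)"

definition cellular_family :: "'a topology \<Rightarrow> 'a set set \<Rightarrow> bool" where
  "cellular_family X \<C> \<longleftrightarrow> (\<forall>C\<in>\<C>. openin X C \<and> C \<noteq> {}) \<and> pairwise disjnt \<C>"

definition cellularity_le :: "'a topology \<Rightarrow> 'k rel \<Rightarrow> bool" where
  "cellularity_le X r \<longleftrightarrow> (\<forall>\<C>. cellular_family X \<C> \<longrightarrow> |\<C>| \<le>o r)"

definition cellularity :: "'a topology \<Rightarrow> ('a set + nat) rel" where
  "cellularity X = least_cardinal (\<lambda>r. Cinfinite r \<and> cellularity_le X r)"

lemma least_cardinal:
  fixes P :: "'k rel \<Rightarrow> bool"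
  assumes "Card_order r0" "P r0"
  shows "Card_order (least_cardinal P) \<and> P (least_cardinal P) \<and>
    (\<forall>s. Card_order s \<and> P s \<longrightarrow> least_cardinal P \<le>o s)"
proof -
  have "\<exists>r\<in>{r. Card_order r \<and> P r}. \<forall>s\<in>{r. Card_order r \<and> P r}. r \<le>o s"
    using assms by (intro exists_minim_Card_order) auto
  then have "\<exists>r. Card_order r \<and> P r \<and> (\<forall>s. Card_order s \<and> P s \<longrightarrow> r \<le>o s)"
    by auto
  then show ?thesis
    unfolding least_cardinal_def by (rule someI_ex)
qed

lemma least_infinite_cardinal:
  fixes P :: "('a + nat) rel \<Rightarrow> bool" and Q :: "'k rel \<Rightarrow> bool"
  assumes top: "P |UNIV :: ('a + nat) set|"
    and transfer: "\<And>r s. Q s \<Longrightarrow> s =o r \<Longrightarrow> P r"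
  shows "Cinfinite (least_cardinal (\<lambda>r. Cinfinite r \<and> P r))"
    and "P (least_cardinal (\<lambda>r. Cinfinite r \<and> P r))"
    and "Cinfinite s \<Longrightarrow> Q s \<Longrightarrow> least_cardinal (\<lambda>r. Cinfinite r \<and> P r) \<le>o s"
proof -
  let ?m = "least_cardinal (\<lambda>r. Cinfinite r \<and> P r)"
  let ?U = "UNIV :: ('a + nat) set"
  have "infinite ?U" by simp
  then have "Cinfinite |?U|"
    unfolding cinfinite_def by (simp only: Field_card_of card_of_card_order_on not_False_eq_True simp_thms)
  with top have m: "Card_order ?m \<and> (Cinfinite ?m \<and> P ?m) \<and>
      (\<forall>s. Card_order s \<and> (Cinfinite s \<and> P s) \<longrightarrow> ?m \<le>o s)"
    by (intro least_cardinal[of "|?U|"]) auto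
  then show "Cinfinite ?m" "P ?m" by auto
  assume s: "Cinfinite s" "Q s"
  show "?m \<le>o s"
  proof (cases "s \<le>o |?U|")
    case True
    then have "|Field s| \<le>o |?U|"
      using s card_of_Field_ordIso ordIso_ordLeq_trans by blast
    then obtain f where f: "inj_on f (Field s)" "f ` Field s \<subseteq> ?U"
      using card_of_ordLeq by metis
    then have "|Field s| =o |f ` Field s|"
      by (meson card_of_ordIso inj_on_imp_bij_betw)
    then have eq: "s =o |f ` Field s|"
      using s card_of_Field_ordIso ordIso_symmetric ordIso_transitive by blast
    then have "P |f ` Field s|" "Cinfinite |f ` Field s|"
      using s transfer Cinfinite_cong by blast+
    then have "?m \<le>o |f ` Field s|" using m by blast
    then show ?thesis using eq ordIso_symmetric ordLeq_ordIso_trans by blast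
  next
    case False
    then have "|?U| \<le>o s"
      using s by (meson card_of_Well_order card_order_on_well_order_on ordLeq_total)
    moreover have "?m \<le>o |?U|" using m top \<open>Cinfinite |?U|\<close> by blast
    ultimately show ?thesis by (rule ordLeq_transitive[rotated])
  qed
qed

lemma top_density:
  shows "\<exists>D. dense_subset X D \<and> |D| =o top_density X"
    and "dense_subset X D \<Longrightarrow> top_density X \<le>o |D|"
proof -
  have "dense_subset X (topspace X)"
    by (simp add: dense_subset_def closure_of_topspace)
  then have "\<exists>D. dense_subset X D \<and> |D| =o |topspace X|" using card_of_refl by blast
  note * = least_cardinal[of "|topspace X|" "\<lambda>r. \<exists>D. dense_subset X D \<and> |D| =o r",
      OF card_of_Card_order this, folded top_density_def]
  show "\<exists>D. dense_subset X D \<and> |D| =o top_density X" using * by blast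
  show "dense_subset X D \<Longrightarrow> top_density X \<le>o |D|"
    using * card_of_Card_order card_of_refl by blast
qed

lemma card_of_le_set_plus_nat: "|\<A> :: 'a set set| \<le>o |UNIV :: ('a set + nat) set|"
  by (rule card_of_ordLeqI[where f = Inl]) auto

lemma pi_character:
  shows "Cinfinite (pi_character X)"
    and "pi_character_le X (pi_character X)"
    and "Cinfinite (s :: 'k rel) \<Longrightarrow> pi_character_le X s \<Longrightarrow> pi_character X \<le>o s"
proof -
  have "local_pi_base X x {U. openin X U \<and> U \<noteq> {}}" for x
    by (auto simp: local_pi_base_def)
  then have top: "pi_character_le X |UNIV :: ('a set + nat) set|"
    using card_of_le_set_plus_nat unfolding pi_character_le_def by blast
  have transfer: "pi_character_le X r" if "pi_character_le X s" "s =o r"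
    for r :: "('a set + nat) rel" and s :: "'k rel"
    using that ordLeq_ordIso_trans unfolding pi_character_le_def by blast
  show "Cinfinite (pi_character X)" "pi_character_le X (pi_character X)"
    unfolding pi_character_def
    by (rule least_infinite_cardinal[where Q = "pi_character_le X :: 'k rel \<Rightarrow> bool"];
        (fact top | erule (1) transfer))+
  show "pi_character X \<le>o s" if "Cinfinite s" "pi_character_le X s"
    unfolding pi_character_def
    by (rule least_infinite_cardinal(3)[where Q = "pi_character_le X"];
        (fact top | fact that | erule (1) transfer))
qed

lemma cellularity:
  shows "Cinfinite (cellularity X)"
    and "cellularity_le X (cellularity X)"
    and "Cinfinite (s :: 'k rel) \<Longrightarrow> cellularity_le X s \<Longrightarrow> cellularity X \<le>o s"
proof -
  have top: "cellularity_le X |UNIV :: ('a set + nat) set|"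
    using card_of_le_set_plus_nat unfolding cellularity_le_def by blast
  have transfer: "cellularity_le X r" if "cellularity_le X s" "s =o r"
    for r :: "('a set + nat) rel" and s :: "'k rel"
    using that ordLeq_ordIso_trans unfolding cellularity_le_def by blast
  show "Cinfinite (cellularity X)" "cellularity_le X (cellularity X)"
    unfolding cellularity_def
    by (rule least_infinite_cardinal[where Q = "cellularity_le X :: 'k rel \<Rightarrow> bool"];
        (fact top | erule (1) transfer))+
  show "cellularity X \<le>o s" if "Cinfinite s" "cellularity_le X s"
    unfolding cellularity_def
    by (rule least_infinite_cardinal(3)[where Q = "cellularity_le X"];
        (fact top | fact that | erule (1) transfer))
qed

end

theory Submission
  imports Defs
begin

text \<open>
  Let \<open>\<kappa> = c(X)\<close> and \<open>\<mu> = \<pi>\<chi>(X)\<^sup>\<kappa>\<close>, so that \<open>\<mu>\<^sup>\<kappa> = \<mu>\<close>. A closing-off argument of length \<open>\<kappa>\<^sup>+\<close>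
  yields a set \<open>D\<close> of at most \<open>\<mu>\<close> points such that, whenever \<open>W\<^sub>0, W\<^sub>1, \<dots>\<close> are families of at most
  \<open>\<kappa>\<close> members of the local \<open>\<pi>\<close>-bases at points of \<open>D\<close> and the closures of the unions \<open>\<Union>W\<^sub>n\<close> do not
  cover \<open>X\<close>, some point of \<open>D\<close> lies outside all these closures. If \<open>D\<close> missed a neighbourhood of
  \<open>q\<close>, then by the Hausdorff and Lindeloef properties the closure of \<open>D\<close> would be covered by
  countably many open \<open>U\<^sub>n\<close>, each disjoint from a neighbourhood of \<open>q\<close>. Let \<open>W\<^sub>n\<close> be a maximal
  disjoint family of members of the \<open>\<pi>\<close>-bases contained in \<open>U\<^sub>n\<close>. Then \<open>|W\<^sub>n| \<le> \<kappa>\<close>, the closure of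
  \<open>\<Union>W\<^sub>n\<close> contains \<open>D \<inter> U\<^sub>n\<close> but not \<open>q\<close>, and so some point of \<open>D\<close> lies outside every \<open>U\<^sub>n\<close>,
  which is absurd.
\<close>

text \<open>Zorn's lemma for disjoint subfamilies: a nonempty member of \<open>\<B>\<close> missing
  \<open>\<Union>\<W>\<close> could be added to \<open>\<W>\<close>.\<close>

lemma exists_maximal_disjoint_subfamily:
  "\<exists>\<W>\<subseteq>\<B>. pairwise disjnt \<W> \<and> (\<forall>B\<in>\<B>. B \<noteq> {} \<longrightarrow> B \<inter> \<Union>\<W> \<noteq> {})"
proof -
  let ?A = "{\<W>. \<W> \<subseteq> \<B> \<and> pairwise disjnt \<W>}"
  have "\<exists>M\<in>?A. \<forall>Y\<in>?A. M \<subseteq> Y \<longrightarrow> Y = M"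
  proof (rule subset_Zorn')
    fix C assume C: "subset.chain ?A C"
    then have "pairwise disjnt (\<Union>C)"
      by (intro pairwise_chain_Union) (auto simp: subset_chain_def chain_subset_def)
    with C show "\<Union>C \<in> ?A"
      by (auto simp: subset.chain_def)
  qed
  then obtain \<W> where \<W>: "\<W> \<subseteq> \<B>" "pairwise disjnt \<W>"
    and max: "\<And>\<Y>. \<Y> \<subseteq> \<B> \<Longrightarrow> pairwise disjnt \<Y> \<Longrightarrow> \<W> \<subseteq> \<Y> \<Longrightarrow> \<Y> = \<W>"
    by auto
  have "B \<inter> \<Union>\<W> \<noteq> {}" if "B \<in> \<B>" "B \<noteq> {}" for B
  proof
    assume disj: "B \<inter> \<Union>\<W> = {}"
    then have "pairwise disjnt (insert B \<W>)"
      using \<W> by (auto simp: pairwise_insert disjnt_def)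
    then have "insert B \<W> = \<W>"
      using that \<W> by (intro max) auto
    then show False using disj that by blast
  qed
  with \<W> show ?thesis by blast
qed

text \<open>Each nonempty such \<open>A\<close> is the range of a function from
  \<open>Field r\<close> to \<open>E\<close>, and there are at most \<open>\<mu> ^c r\<close> of
  these; the empty set is counted separately.\<close>

lemma card_of_bounded_subsets_ordLeq:
  assumes "Cinfinite r" "Card_order \<mu>" "infinite (Field \<mu>)" "\<mu> ^c r \<le>o \<mu>" "|E| \<le>o \<mu>"
  shows "|{A. A \<subseteq> E \<and> |A| \<le>o r}| \<le>o \<mu>"
proof -
  let ?F = "Func (Field r) E"
  have "{A. A \<subseteq> E \<and> |A| \<le>o r} \<subseteq> insert {} ((\<lambda>f. f ` Field r) ` ?F)"
  proof clarsimp
    fix A assume A: "A \<subseteq> E" "|A| \<le>o r" "A \<notin> (\<lambda>f. f ` Field r) ` ?F"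
    have "|A| \<le>o |Field r|"
      using A(2) assms(1) card_of_Field_ordIso ordIso_symmetric ordLeq_ordIso_trans by blast
    then have "\<exists>g. g ` Field r = A" if "A \<noteq> {}"
      using that card_of_ordLeq2 by metis
    moreover have False if g: "g ` Field r = A" for g
    proof -
      \<comment> \<open>\<open>Func\<close> requires the value \<open>undefined\<close> outside
        \<open>Field r\<close>.\<close>
      let ?g = "\<lambda>x. if x \<in> Field r then g x else undefined"
      have "?g \<in> ?F" "?g ` Field r = A"
        using g A(1) by (auto simp: Func_def)
      then show False using A(3) by blast
    qed
    ultimately show "A = {}" by blast
  qed
  then have "|{A. A \<subseteq> E \<and> |A| \<le>o r}| \<le>o |insert {} ((\<lambda>f. f ` Field r) ` ?F)|"
    by (rule card_of_mono1)
  moreover have "|insert {} ((\<lambda>f. f ` Field r) ` ?F)| \<le>o \<mu>"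
  proof -
    have "|?F| =o |E| ^c r"
      unfolding cexp_def Field_card_of by (rule card_of_refl)
    moreover have "|E| ^c r \<le>o \<mu> ^c r"
      using assms by (intro cexp_mono1) auto
    ultimately have "|?F| \<le>o \<mu>"
      using assms(4) ordIso_ordLeq_trans ordLeq_transitive by blast
    then have "|(\<lambda>f. f ` Field r) ` ?F| \<le>o \<mu>"
      using card_of_image ordLeq_transitive by blast
    moreover have "|{{}}| \<le>o \<mu>"
      using assms(2,3) by (intro Card_order_singl_ordLeq) auto
    ultimately have "|{{}} \<union> ((\<lambda>f. f ` Field r) ` ?F)| \<le>o \<mu>"
      using assms(2,3) by (intro card_of_Un_ordLeq_infinite_Field) auto
    then show ?thesis by simp
  qed
  ultimately show ?thesis by (rule ordLeq_transitive)
qed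

text \<open>Transfinite recursion along the successor cardinal of \<open>r\<close>, written as an
  inductive predicate: stage \<open>i\<close> collects the sets \<open>G A\<close> for small
  \<open>A\<close> inside a single earlier stage \<open>j\<close>.\<close>

inductive closing_stage :: "'k rel \<Rightarrow> ('b set \<Rightarrow> 'b set) \<Rightarrow> 'k set \<Rightarrow> 'b \<Rightarrow> bool"
  for r G where
  "j \<in> underS (cardSuc r) i \<Longrightarrow> \<forall>a\<in>A. closing_stage r G j a \<Longrightarrow> |A| \<le>o r \<Longrightarrow> x \<in> G A
    \<Longrightarrow> closing_stage r G i x"

text \<open>The union of all stages is closed under \<open>G\<close>: the successor cardinal is
  regular, so a subset of size at most \<open>r\<close> already lies in one stage, and
  \<open>G\<close> of it lies in any later one.\<close>

lemma closing_off:
  fixes r :: "'k rel" and \<mu> :: "'m rel" and G :: "'b set \<Rightarrow> 'b set"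
  assumes r: "Cinfinite r" and \<mu>: "Cinfinite \<mu>" "\<mu> ^c r \<le>o \<mu>"
    and G: "\<And>A. |A| \<le>o r \<Longrightarrow> |G A| \<le>o \<mu>"
  obtains D where "|D| \<le>o \<mu>" "\<And>A. A \<subseteq> D \<Longrightarrow> |A| \<le>o r \<Longrightarrow> G A \<subseteq> D"
proof -
  let ?k = "cardSuc r"
  define S where "S i = {x. closing_stage r G i x}" for i
  have S_eq: "S i = (\<Union>j\<in>underS ?k i. \<Union>A\<in>{A. A \<subseteq> S j \<and> |A| \<le>o r}. G A)" for i
  proof (rule set_eqI)
    show "x \<in> S i \<longleftrightarrow> x \<in> (\<Union>j\<in>underS ?k i. \<Union>A\<in>{A. A \<subseteq> S j \<and> |A| \<le>o r}. G A)" for x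
      unfolding S_def mem_Collect_eq closing_stage.simps[of r G i x] subset_eq by blast
  qed
  have \<mu>': "Card_order \<mu>" "infinite (Field \<mu>)" using \<mu> by (auto simp: cinfinite_def)
  have r': "Card_order r" "infinite (Field r)" using r by (auto simp: cinfinite_def)
  have k: "Card_order ?k" "infinite (Field ?k)"
    using r' by (auto simp: cardSuc_Card_order cardSuc_finite)
  then have "Well_order ?k" by (simp add: card_order_on_def)
  then interpret k: wo_rel ?k by (simp add: wo_rel_def)
  have "ctwo \<le>o \<mu>"
    using \<mu>(1) ctwo_ordLess_Cinfinite ordLess_imp_ordLeq by blast
  then have "ctwo ^c r \<le>o \<mu> ^c r"
    using r by (intro cexp_mono1) auto
  \<comment> \<open>Cantor: \<open>r\<close> is below \<open>ctwo ^c r\<close>, hence below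
    \<open>\<mu>\<close>. So there are at most \<open>\<mu>\<close> stages.\<close>
  then have "r <o \<mu>"
    using ordLess_ctwo_cexp[OF r'(1)] \<mu>(2) ordLess_ordLeq_trans ordLeq_transitive by blast
  then have k_le: "?k \<le>o \<mu>" by (rule cardSuc_least[OF r'(1) \<mu>'(1)])
  have small: "|S i| \<le>o \<mu>" for i
  proof (induction i rule: k.well_order_induct)
    case (1 i)
    have "|underS ?k i| \<le>o \<mu>"
    proof (cases "i \<in> Field ?k")
      case True
      then show ?thesis
        using card_of_underS[OF k(1)] k_le ordLess_ordLeq_trans ordLess_imp_ordLeq by blast
    next
      case False
      then have "underS ?k i = {}" by (auto simp: underS_def Field_def)
      then show ?thesis using \<mu>' by (simp add: card_of_empty1)
    qed
    moreover have "|\<Union>A\<in>{A. A \<subseteq> S j \<and> |A| \<le>o r}. G A| \<le>o \<mu>" if "j \<in> underS ?k i" for j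
    proof (rule card_of_UNION_ordLeq_infinite_Field[OF \<mu>'(2,1)])
      have "|S j| \<le>o \<mu>" using 1 that by (auto simp: underS_def)
      then show "|{A. A \<subseteq> S j \<and> |A| \<le>o r}| \<le>o \<mu>"
        by (rule card_of_bounded_subsets_ordLeq[OF r \<mu>' \<mu>(2)])
    qed (use G in auto)
    ultimately show ?case
      unfolding S_eq[of i] by (intro card_of_UNION_ordLeq_infinite_Field[OF \<mu>'(2,1)]) auto
  qed
  have "S i \<subseteq> S j" if "(i, j) \<in> ?k" for i j
  proof -
    have "underS ?k i \<subseteq> underS ?k j"
      using that k.ANTISYM k.TRANS by (auto simp: underS_def antisym_def dest: transD)
    then show ?thesis unfolding S_eq[of i] S_eq[of j] by blast
  qed
  then have chain: "relChain ?k S" by (simp add: relChain_def)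
  show thesis
  proof (rule that[of "\<Union>i\<in>Field ?k. S i"])
    have "|Field ?k| \<le>o \<mu>"
      using k_le k(1) card_of_Field_ordIso ordIso_ordLeq_trans by blast
    then show "|\<Union>i\<in>Field ?k. S i| \<le>o \<mu>"
      using small by (intro card_of_UNION_ordLeq_infinite_Field[OF \<mu>'(2,1)]) auto
    fix A assume A: "A \<subseteq> (\<Union>i\<in>Field ?k. S i)" "|A| \<le>o r"
    then obtain i where i: "i \<in> Field ?k" "A \<subseteq> S i"
      using cardSuc_UNION[OF r' chain] by blast
    then obtain j where j: "j \<in> Field ?k" "i \<noteq> j" "(i, j) \<in> ?k"
      using infinite_Card_order_limit[OF k] by blast
    then have "G A \<subseteq> S j"
      using i A(2) unfolding S_eq[of j] by (auto simp: underS_def)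
    with j show "G A \<subseteq> (\<Union>i\<in>Field ?k. S i)" by blast
  qed
qed

text \<open>Points of \<open>F\<close> are separated from \<open>q\<close> by open sets whose
  closures miss \<open>q\<close>. With the complement of \<open>F\<close> these cover
  \<open>X\<close>, and the Lindeloef property leaves countably many.\<close>

lemma Lindelof_Hausdorff_separating_sequence:
  fixes X :: "'a topology"
  assumes "Lindelof_space X" "Hausdorff_space X" "closedin X F" "q \<in> topspace X" "q \<notin> F"
  shows "\<exists>U :: nat \<Rightarrow> 'a set. (\<forall>n. openin X (U n) \<and> q \<notin> X closure_of (U n)) \<and> F \<subseteq> (\<Union>n. U n)"
proof -
  let ?\<U> = "{U. openin X U \<and> q \<notin> X closure_of U}"
  have "\<exists>U\<in>?\<U>. x \<in> U" if "x \<in> F" for x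
  proof -
    have "x \<in> topspace X" "x \<noteq> q"
      using that assms(3,5) closedin_subset by blast+
    then obtain U V where "openin X U" "openin X V" "x \<in> U" "q \<in> V" "disjnt U V"
      using assms(2,4) unfolding Hausdorff_space_def by blast
    then have "U \<in> ?\<U>" by (auto simp: in_closure_of disjnt_iff)
    with \<open>x \<in> U\<close> show ?thesis by blast
  qed
  then have "topspace X \<subseteq> \<Union>(insert (topspace X - F) ?\<U>)" by blast
  moreover have "openin X (topspace X - F)" using assms(3) by blast
  ultimately obtain \<V> where \<V>: "countable \<V>" "\<V> \<subseteq> insert (topspace X - F) ?\<U>" "topspace X \<subseteq> \<Union>\<V>"
    using assms(1) unfolding Lindelof_space_alt by (metis (mono_tags, lifting) insert_iff mem_Collect_eq)
  \<comment> \<open>Adding the empty set makes the family nonempty, so that it can be enumerated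
    even when \<open>F\<close> is empty.\<close>
  define \<V>' where "\<V>' = insert {} (\<V> \<inter> ?\<U>)"
  have \<V>': "countable \<V>'" "\<V>' \<noteq> {}" "\<V>' \<subseteq> ?\<U>"
    using \<V>(1) by (auto simp: \<V>'_def)
  have "F \<subseteq> \<Union>\<V>'"
    using \<V>(2,3) closedin_subset[OF assms(3)] unfolding \<V>'_def by blast
  moreover have "(\<Union>n. from_nat_into \<V>' n) = \<Union>\<V>'"
    using \<V>' by (simp add: range_from_nat_into)
  moreover have "from_nat_into \<V>' n \<in> ?\<U>" for n
    using \<V>' from_nat_into[of \<V>'] by blast
  ultimately show ?thesis by (intro exI[of _ "from_nat_into \<V>'"]) auto
qed

text \<open>If \<open>T\<close> is a neighbourhood of \<open>x\<close> in
  \<open>D \<inter> U\<close>, then \<open>T \<inter> U\<close> contains a member of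
  \<open>\<B> x\<close>, which meets \<open>\<Union>\<W>\<close>.\<close>

lemma closure_of_maximal_pi_base_subfamily:
  assumes D: "D \<subseteq> topspace X" and base: "\<And>x. x \<in> D \<Longrightarrow> local_pi_base X x (\<B> x)"
    and U: "openin X U"
    and max: "\<And>B x. x \<in> D \<Longrightarrow> B \<in> \<B> x \<Longrightarrow> B \<subseteq> U \<Longrightarrow> B \<inter> \<Union>\<W> \<noteq> {}"
  shows "D \<inter> U \<subseteq> X closure_of \<Union>\<W>"
proof
  fix x assume x: "x \<in> D \<inter> U"
  have "\<exists>y. y \<in> \<Union>\<W> \<and> y \<in> T" if T: "x \<in> T" "openin X T" for T
  proof -
    have "openin X (T \<inter> U)" "x \<in> T \<inter> U" using T U x by auto
    then obtain B where "B \<in> \<B> x" "B \<subseteq> T \<inter> U"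
      using base x unfolding local_pi_base_def by blast
    then show ?thesis using max[of x B] x by blast
  qed
  then show "x \<in> X closure_of \<Union>\<W>" using x D by (auto simp: in_closure_of)
qed

theorem corollary2p13:
  fixes X :: "'a topology"
  assumes "Lindelof_space X" and "Hausdorff_space X"
  shows "top_density X \<le>o pi_character X ^c cellularity X"
proof -
  define \<tau> where "\<tau> = pi_character X"
  define \<kappa> where "\<kappa> = cellularity X"
  define \<mu> where "\<mu> = \<tau> ^c \<kappa>"
  have \<tau>: "Cinfinite \<tau>" "pi_character_le X \<tau>" unfolding \<tau>_def by (rule pi_character)+
  have \<kappa>: "Cinfinite \<kappa>" "cellularity_le X \<kappa>" unfolding \<kappa>_def by (rule cellularity)+
  have "ctwo \<le>o \<tau>"
    using \<tau>(1) ctwo_ordLess_Cinfinite ordLess_imp_ordLeq by blast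
  then have \<mu>: "Cinfinite \<mu>" unfolding \<mu>_def using \<kappa>(1) by (rule Cinfinite_cexp)
  then have \<mu>': "Card_order \<mu>" "infinite (Field \<mu>)" by (auto simp: cinfinite_def)
  \<comment> \<open>\<open>(\<tau>^\<kappa>)^\<kappa> = \<tau>^(\<kappa> * \<kappa>) =
    \<tau>^\<kappa>\<close>.\<close>
  have "\<mu> ^c \<kappa> =o \<mu>"
    unfolding \<mu>_def
    using \<tau>(1) \<kappa>(1) Cinfinite_Cnotzero ordLeq_refl by (intro cexp_cprod_ordLeq) auto
  then have \<mu>_exp: "\<mu> ^c \<kappa> \<le>o \<mu>" by (rule ordIso_imp_ordLeq)
  have "\<tau> \<le>o \<mu>"
    unfolding \<mu>_def using \<tau>(1) \<kappa>(1) Cinfinite_Cnotzero by (intro ordLeq_cexp1) auto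
  have nat_le: "|UNIV :: nat set| \<le>o s" if "Cinfinite s" for s :: "'c rel"
    using that card_of_nat natLeq_ordLeq_cinfinite ordIso_ordLeq_trans by blast

  \<comment> \<open>Points outside the space receive the empty family, so the bound on
    \<open>\<B> x\<close> holds for every \<open>x\<close>.\<close>
  have "\<exists>\<B>. (x \<in> topspace X \<longrightarrow> local_pi_base X x \<B>) \<and> |\<B>| \<le>o \<tau>" for x
  proof (cases "x \<in> topspace X")
    case True
    then show ?thesis using \<tau>(2) unfolding pi_character_le_def by blast
  next
    case False
    moreover have "|{}| \<le>o \<tau>" using \<tau>(1) by (simp add: card_of_empty1)
    ultimately show ?thesis by blast
  qed
  then obtain \<B> where base: "\<And>x. x \<in> topspace X \<Longrightarrow> local_pi_base X x (\<B> x)"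
    and \<B>_le: "\<And>x. |\<B> x| \<le>o \<tau>"
    by metis

  text \<open>A subset of \<^typ>\<open>nat \<times> 'a set\<close> encodes a sequence of families of sets.\<close>
  define C where "C A = (\<Union>n::nat. X closure_of \<Union>(A `` {n}))" for A
  \<comment> \<open>If \<open>C A\<close> covers the space, \<open>p A\<close> is arbitrary; hence
    the intersection with \<open>topspace X\<close> in \<open>D\<close>.\<close>
  define p where "p A = (SOME x. x \<in> topspace X - C A)" for A
  have "|(UNIV :: nat set) \<times> \<B> (p A)| \<le>o \<mu>" for A
    using \<mu>' nat_le[OF \<mu>] ordLeq_transitive[OF \<B>_le \<open>\<tau> \<le>o \<mu>\<close>]
    by (intro card_of_Times_ordLeq_infinite_Field)
  \<comment> \<open>What is closed off is the set of pairs of an index and a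
    \<open>\<pi>\<close>-base member, not the set of points. All indices are added at once, so a
    member may enter any family of a sequence.\<close>
  then obtain E where E: "|E| \<le>o \<mu>"
    "\<And>A. A \<subseteq> E \<Longrightarrow> |A| \<le>o \<kappa> \<Longrightarrow> UNIV \<times> \<B> (p A) \<subseteq> E"
    using closing_off[OF \<kappa>(1) \<mu> \<mu>_exp, of "\<lambda>A. UNIV \<times> \<B> (p A)"] by metis
  define D where "D = topspace X \<inter> p ` {A. A \<subseteq> E \<and> |A| \<le>o \<kappa>}"
  have "|D| \<le>o |p ` {A. A \<subseteq> E \<and> |A| \<le>o \<kappa>}|"
    unfolding D_def by (intro card_of_mono1) blast
  also have "|p ` {A. A \<subseteq> E \<and> |A| \<le>o \<kappa>}| \<le>o |{A. A \<subseteq> E \<and> |A| \<le>o \<kappa>}|"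
    by (rule card_of_image)
  also have "|{A. A \<subseteq> E \<and> |A| \<le>o \<kappa>}| \<le>o \<mu>"
    by (rule card_of_bounded_subsets_ordLeq[OF \<kappa>(1) \<mu>' \<mu>_exp E(1)])
  finally have D_le: "|D| \<le>o \<mu>" .
  have D_sub: "D \<subseteq> topspace X" by (simp add: D_def)

  have "q \<in> X closure_of D" if q: "q \<in> topspace X" for q
  proof (rule ccontr)
    assume "q \<notin> X closure_of D"
    then have "\<exists>U :: nat \<Rightarrow> 'a set. (\<forall>n. openin X (U n) \<and> q \<notin> X closure_of (U n)) \<and>
        X closure_of D \<subseteq> (\<Union>n. U n)"
      by (rule Lindelof_Hausdorff_separating_sequence[OF assms closedin_closure_of q])
    then obtain U :: "nat \<Rightarrow> 'a set" where "(\<forall>n. openin X (U n) \<and> q \<notin> X closure_of (U n)) \<and>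
        X closure_of D \<subseteq> (\<Union>n. U n)" ..
    then have U: "openin X (U n)" "q \<notin> X closure_of (U n)" "X closure_of D \<subseteq> (\<Union>n. U n)" for n
      by simp_all
    define \<B>U where "\<B>U n = {B \<in> \<Union>(\<B> ` D). B \<subseteq> U n}" for n
    have "\<forall>n. \<exists>W\<subseteq>\<B>U n. pairwise disjnt W \<and> (\<forall>B\<in>\<B>U n. B \<noteq> {} \<longrightarrow> B \<inter> \<Union>W \<noteq> {})"
      by (intro allI exists_maximal_disjoint_subfamily)
    then obtain W where W: "\<And>n. W n \<subseteq> \<B>U n" "\<And>n. pairwise disjnt (W n)"
      "\<And>n B. B \<in> \<B>U n \<Longrightarrow> B \<noteq> {} \<Longrightarrow> B \<inter> \<Union>(W n) \<noteq> {}"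
      by metis
    have open_B: "openin X B \<and> B \<noteq> {}" if "B \<in> \<B> x" "x \<in> D" for B x
      using that base D_sub unfolding local_pi_base_def by blast
    have "cellular_family X (W n)" for n
      using W(1)[of n] W(2)[of n] open_B unfolding cellular_family_def \<B>U_def by blast
    then have W_le: "|W n| \<le>o \<kappa>" for n
      using \<kappa>(2) unfolding cellularity_le_def by blast
    \<comment> \<open>The code of the sequence \<open>W\<close>. It lies in \<open>E\<close> because
      each point of \<open>D\<close> is \<open>p A'\<close> for some small
      \<open>A' \<subseteq> E\<close>, so \<open>E\<close> contains its \<open>\<pi>\<close>-base
      with every index.\<close>
    define A where "A = Sigma UNIV W"
    have "|A| \<le>o \<kappa>"
      unfolding A_def using W_le nat_le[OF \<kappa>(1)] \<kappa>(1)
      by (intro card_of_Sigma_ordLeq_infinite_Field) (auto simp: cinfinite_def)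
    moreover have "A \<subseteq> E"
    proof
      fix z assume "z \<in> A"
      then obtain n B x where "z = (n, B)" "B \<in> \<B> x" "x \<in> D"
        using W(1) unfolding A_def \<B>U_def by blast
      then show "z \<in> E" using E(2) unfolding D_def by blast
    qed
    moreover have C_A: "C A = (\<Union>n. X closure_of \<Union>(W n))"
      by (simp add: C_def A_def Sigma_def Image_def)
    have "q \<notin> X closure_of \<Union>(W n)" for n
    proof -
      have "\<Union>(W n) \<subseteq> U n" using W(1)[of n] unfolding \<B>U_def by blast
      then show ?thesis using U(2) closure_of_mono by blast
    qed
    \<comment> \<open>The point \<open>q\<close> shows that the choice defining \<open>p A\<close>
      succeeds.\<close>
    then have "q \<in> topspace X - C A" using q C_A by blast
    then have p: "p A \<in> topspace X - C A" unfolding p_def by (rule someI)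
    ultimately have "p A \<in> D" unfolding D_def by blast
    \<comment> \<open>Being in \<open>D\<close>, the point \<open>p A\<close> lies in some
      \<open>U n\<close>, hence in the closure of \<open>\<Union>(W n)\<close>, a part of
      \<open>C A\<close>, which it was chosen to avoid.\<close>
    then obtain n where "p A \<in> U n"
      using U(3) closure_of_subset[OF D_sub] by blast
    moreover have "D \<inter> U n \<subseteq> X closure_of \<Union>(W n)"
    proof (rule closure_of_maximal_pi_base_subfamily[OF D_sub _ U(1)])
      show "local_pi_base X x (\<B> x)" if "x \<in> D" for x using base D_sub that by blast
      show "B \<inter> \<Union>(W n) \<noteq> {}" if "x \<in> D" "B \<in> \<B> x" "B \<subseteq> U n" for B x
        using W(3)[of B n] that open_B unfolding \<B>U_def by blast
    qed
    ultimately show False using p \<open>p A \<in> D\<close> C_A by blast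
  qed
  then have "dense_subset X D"
    unfolding dense_subset_def using D_sub closure_of_subset_topspace[of X D] by blast
  then have "top_density X \<le>o |D|" by (rule top_density)
  then show ?thesis using D_le unfolding \<mu>_def \<tau>_def \<kappa>_def by (rule ordLeq_transitive)
qed

end
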